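(* For any integers $1\le k\le n$, the $k$-equal partition lattice $\Pi_{n,k}$ is comodernistic.
   Context: $\Pi_{n,k}$ is the subposet of the partition lattice $\Pi_n$ of $[n]=\{1,\dots,n\}$ (ordered by refinement) consisting of all partitions whose non-singleton blocks have size at least $k$; it is a lattice. An element $m$ of a lattice $L$ is left-modular if $(x\vee m)\wedge y=x\vee(m\wedge y)$ for all $x<y$ in $L$. A lattice is comodernistic if every interval $[u,v]$ has a coatom that is left-modular as an element of $[u,v]$. *)

theory Defs
  imports "HOL-Algebra.Lattice" "HOL-Library.Disjoint_Sets"
begin

definition partition_lattice :: "nat \<Rightarrow> nat set set gorder" where
  "partition_lattice n =
     \<lparr>carrier = {P. partition_on {1..n} P}, eq = (=), le = refines {1..n}\<rparr>"

definition k_equal_partition_lattice :: "nat \<Rightarrow> nat \<Rightarrow> nat set set gorder" where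
  "k_equal_partition_lattice n k =
     (partition_lattice n)
       \<lparr>carrier := {P \<in> carrier (partition_lattice n). \<forall>B\<in>P. card B \<noteq> 1 \<longrightarrow> k \<le> card B}\<rparr>"

definition interval :: "('a, 'b) gorder_scheme \<Rightarrow> 'a \<Rightarrow> 'a \<Rightarrow> ('a, 'b) gorder_scheme" where
  "interval L u v = L\<lparr>carrier := \<lbrace>u..v\<rbrace>\<^bsub>L\<^esub>\<rparr>"

definition coatom :: "('a, 'b) gorder_scheme \<Rightarrow> 'a \<Rightarrow> bool" where
  "coatom L m \<longleftrightarrow>
     m \<in> carrier L \<and> m \<sqsubset>\<^bsub>L\<^esub> \<top>\<^bsub>L\<^esub> \<and> \<not> (\<exists>z\<in>carrier L. m \<sqsubset>\<^bsub>L\<^esub> z \<and> z \<sqsubset>\<^bsub>L\<^esub> \<top>\<^bsub>L\<^esub>)"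

definition left_modular :: "('a, 'b) gorder_scheme \<Rightarrow> 'a \<Rightarrow> bool" where
  "left_modular L m \<longleftrightarrow>
     m \<in> carrier L \<and>
     (\<forall>x\<in>carrier L. \<forall>y\<in>carrier L. x \<sqsubset>\<^bsub>L\<^esub> y \<longrightarrow>
        (x \<squnion>\<^bsub>L\<^esub> m) \<sqinter>\<^bsub>L\<^esub> y = x \<squnion>\<^bsub>L\<^esub> (m \<sqinter>\<^bsub>L\<^esub> y))"

text \<open>One-point intervals have no coatoms, so only intervals with distinct endpoints are meant.\<close>

definition comodernistic :: "('a, 'b) gorder_scheme \<Rightarrow> bool" where
  "comodernistic L \<longleftrightarrow>
     lattice L \<and>
     (\<forall>u\<in>carrier L. \<forall>v\<in>carrier L. u \<sqsubset>\<^bsub>L\<^esub> v \<longrightarrow>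
        (\<exists>m. coatom (interval L u v) m \<and> left_modular (interval L u v) m))"

end

theory Submission
  imports Defs
begin

text \<open>
  Let \<open>u < v\<close>. Choose a block \<open>C\<close> of \<open>v\<close> that is not a block of \<open>u\<close> and a block \<open>D\<close> of \<open>u\<close> inside \<open>C\<close>,
  taking a singleton if there is one. Let \<open>m\<close> be \<open>v\<close> with \<open>C\<close> split into \<open>D\<close> and \<open>C - D\<close>, where \<open>C - D\<close>
  is shattered into singletons if it is too small to be a block. An element \<open>p\<close> of \<open>[u, v]\<close> lies
  below \<open>m\<close> iff \<open>D\<close> is a block of \<open>p\<close>. If it is not and \<open>p \<le> q\<close>, then applying the same splitting
  to \<open>q\<close> gives some \<open>z \<le> m \<sqinter> q\<close> with \<open>p \<squnion> z = q\<close>. This exchange property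
  yields left modularity, and with \<open>q = v\<close> it shows that \<open>m\<close> is a coatom.
\<close>

section \<open>Gluing partitions of blocks; joins obtained from meets\<close>

lemma partition_on_UN:
  assumes P: "partition_on A P" and f: "\<And>B. B \<in> P \<Longrightarrow> partition_on B (f B)"
  shows "partition_on A (\<Union>B\<in>P. f B)"
proof (rule partition_onI)
  show "\<Union>(\<Union>B\<in>P. f B) = A"
    using partition_onD1[OF P] partition_onD1[OF f] by blast
  show "{} \<notin> (\<Union>B\<in>P. f B)"
    using partition_onD3[OF f] by blast
  fix X Y assume "X \<in> (\<Union>B\<in>P. f B)" "Y \<in> (\<Union>B\<in>P. f B)" and ne: "X \<noteq> Y"
  then obtain B C where B: "B \<in> P" "X \<in> f B" and C: "C \<in> P" "Y \<in> f C"
    by auto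
  show "disjnt X Y"
  proof (cases "B = C")
    case True
    then show ?thesis
      using partition_onD2[OF f[OF B(1)]] B C ne by (auto dest: pairwiseD)
  next
    case False
    then have "disjnt B C"
      using partition_onD2[OF P] B C by (auto dest: pairwiseD)
    moreover have "X \<subseteq> B" "Y \<subseteq> C"
      using partition_onD1[OF f] B C by blast+
    ultimately show ?thesis
      by (auto simp: disjnt_iff)
  qed
qed

lemma partition_on_same_block:
  assumes "partition_on A P" "B \<in> P" "C \<in> P" "x \<in> B" "x \<in> C"
  shows "B = C"
  using assms unfolding partition_on_def disjoint_def by blast

text \<open>The join is the meet of all common upper bounds, a finite set that is nonempty because
  of \<open>t\<close>. Joins of k-equal partitions thus need no explicit description.\<close>

lemma (in weak_lower_semilattice) finite_top_imp_sup_of_two: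
  assumes fin: "finite (carrier L)"
    and t: "t \<in> carrier L" "\<And>x. x \<in> carrier L \<Longrightarrow> x \<sqsubseteq> t"
    and xy: "x \<in> carrier L" "y \<in> carrier L"
  shows "\<exists>s. least L s (Upper L {x, y})"
proof -
  have U: "Upper L {x, y} \<subseteq> carrier L"
    by simp
  moreover have "t \<in> Upper L {x, y}"
    using t xy by (auto intro: Upper_memI)
  ultimately have g: "greatest L (\<Sqinter>(Upper L {x, y})) (Lower L (Upper L {x, y}))"
    using fin by (intro finite_inf_greatest) (auto intro: finite_subset)
  have "least L (\<Sqinter>(Upper L {x, y})) (Upper L {x, y})"
  proof (rule least_UpperI)
    show "z \<sqsubseteq> \<Sqinter>(Upper L {x, y})" if "z \<in> {x, y}" for z
      using that xy by (intro greatest_le[OF g] Lower_memI) auto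
    show "\<Sqinter>(Upper L {x, y}) \<sqsubseteq> z" if "z \<in> Upper L {x, y}" for z
      using greatest_Lower_below[OF g that U] .
    show "{x, y} \<subseteq> carrier L" "\<Sqinter>(Upper L {x, y}) \<in> carrier L"
      using xy greatest_closed[OF g] by auto
  qed
  then show ?thesis ..
qed

subsection \<open>Left-modular coatoms of intervals\<close>

lemma interval_simps [simp]:
  "carrier (interval L u v) = {x \<in> carrier L. u \<sqsubseteq>\<^bsub>L\<^esub> x \<and> x \<sqsubseteq>\<^bsub>L\<^esub> v}"
  "le (interval L u v) = le L" "eq (interval L u v) = eq L"
  by (auto simp: interval_def at_least_at_most_def)

context lattice
begin

lemma partial_order_interval: "partial_order (interval L u v)"
  by unfold_locales (auto intro: sym trans le_trans simp: eq_is_equal)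

lemma lattice_interval:
  assumes uv: "u \<in> carrier L" "v \<in> carrier L"
  shows "lattice (interval L u v)"
proof -
  interpret I: partial_order "interval L u v"
    by (rule partial_order_interval)
  show ?thesis
  proof unfold_locales
    fix x y assume x: "x \<in> carrier (interval L u v)" and y: "y \<in> carrier (interval L u v)"
    have "least (interval L u v) (x \<squnion> y) (Upper (interval L u v) {x, y})"
    proof (rule least_UpperI)
      show "z \<sqsubseteq>\<^bsub>interval L u v\<^esub> x \<squnion> y" if "z \<in> {x, y}" for z
        using that x y by (auto intro: join_left join_right)
      show "x \<squnion> y \<sqsubseteq>\<^bsub>interval L u v\<^esub> z" if "z \<in> Upper (interval L u v) {x, y}" for z
        using that x y by (auto simp: Upper_def intro!: join_le)
      show "x \<squnion> y \<in> carrier (interval L u v)"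
        using x y uv by (auto intro: join_le le_trans[OF _ join_left])
    qed (use x y in auto)
    then show "\<exists>s. least (interval L u v) s (Upper (interval L u v) {x, y})" ..
    have "greatest (interval L u v) (x \<sqinter> y) (Lower (interval L u v) {x, y})"
    proof (rule greatest_LowerI)
      show "x \<sqinter> y \<sqsubseteq>\<^bsub>interval L u v\<^esub> z" if "z \<in> {x, y}" for z
        using that x y by (auto intro: meet_left meet_right)
      show "z \<sqsubseteq>\<^bsub>interval L u v\<^esub> x \<sqinter> y" if "z \<in> Lower (interval L u v) {x, y}" for z
        using that x y by (auto simp: Lower_def intro!: meet_le)
      show "x \<sqinter> y \<in> carrier (interval L u v)"
        using x y uv by (auto intro: meet_le le_trans[OF meet_left])
    qed (use x y in auto)
    then show "\<exists>s. greatest (interval L u v) s (Lower (interval L u v) {x, y})" ..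
  qed
qed

text \<open>The witness \<open>z\<close> only needs to lie below \<open>m \<sqinter> q\<close> and join with \<open>p\<close> to something above \<open>q\<close>,
  so no meet has to be computed. When \<open>p \<sqsubseteq> m\<close>, the modular identity is automatic.\<close>

lemma left_modularI:
  assumes m: "m \<in> carrier L"
    and ex: "\<And>p q. \<lbrakk>p \<in> carrier L; q \<in> carrier L; p \<sqsubseteq> q; \<not> p \<sqsubseteq> m\<rbrakk> \<Longrightarrow>
      \<exists>z\<in>carrier L. z \<sqsubseteq> m \<and> z \<sqsubseteq> q \<and> (\<forall>w\<in>carrier L. p \<sqsubseteq> w \<longrightarrow> z \<sqsubseteq> w \<longrightarrow> q \<sqsubseteq> w)"
  shows "left_modular L m"
  unfolding left_modular_def
proof (intro conjI ballI impI m)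
  fix p q assume p: "p \<in> carrier L" and q: "q \<in> carrier L" and "p \<sqsubset> q"
  then have pq: "p \<sqsubseteq> q"
    by (simp add: lless_def)
  have mq: "m \<sqinter> q \<sqsubseteq> m" "m \<sqinter> q \<sqsubseteq> q" "m \<sqinter> q \<in> carrier L"
    using m q by (auto intro: meet_left meet_right)
  have le: "p \<squnion> (m \<sqinter> q) \<sqsubseteq> (p \<squnion> m) \<sqinter> q"
    using m p q pq mq
    by (intro join_le meet_le) (auto intro: join_left le_trans[OF _ join_right])
  have ge: "(p \<squnion> m) \<sqinter> q \<sqsubseteq> p \<squnion> (m \<sqinter> q)"
  proof (cases "p \<sqsubseteq> m")
    case True
    then have "p \<squnion> m \<sqsubseteq> m"
      using m p by (intro join_le) auto
    then have "(p \<squnion> m) \<sqinter> q \<sqsubseteq> m \<sqinter> q"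
      using m p q by (intro meet_le) (auto intro: le_trans[OF meet_left] meet_right)
    then show ?thesis
      by (rule le_trans[OF _ join_right]) (use m p q in auto)
  next
    case False
    then obtain z where z: "z \<in> carrier L" "z \<sqsubseteq> m" "z \<sqsubseteq> q"
      and w: "\<And>w. w \<in> carrier L \<Longrightarrow> p \<sqsubseteq> w \<Longrightarrow> z \<sqsubseteq> w \<Longrightarrow> q \<sqsubseteq> w"
      using ex[OF p q pq] by blast
    have "z \<sqsubseteq> m \<sqinter> q"
      using z m q by (intro meet_le)
    then have "z \<sqsubseteq> p \<squnion> (m \<sqinter> q)"
      by (rule le_trans[OF _ join_right]) (use z m p q in auto)
    then have "q \<sqsubseteq> p \<squnion> (m \<sqinter> q)"
      using m p q mq by (intro w) (auto intro: join_left)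
    then show ?thesis
      using m p q mq by (intro le_trans[OF meet_right]) auto
  qed
  show "(p \<squnion> m) \<sqinter> q = p \<squnion> (m \<sqinter> q)"
    using le ge m p q by (intro le_antisym) auto
qed

lemma interval_left_modular_coatomI:
  assumes uv: "u \<in> carrier L" "v \<in> carrier L" "u \<sqsubseteq> v"
    and m: "m \<in> carrier L" "u \<sqsubseteq> m" "m \<sqsubseteq> v" "m \<noteq> v"
    and ex: "\<And>p q. \<lbrakk>p \<in> carrier L; q \<in> carrier L; u \<sqsubseteq> p; p \<sqsubseteq> q; q \<sqsubseteq> v; \<not> p \<sqsubseteq> m\<rbrakk> \<Longrightarrow>
      \<exists>z\<in>carrier L. u \<sqsubseteq> z \<and> z \<sqsubseteq> m \<and> z \<sqsubseteq> q \<and> (\<forall>w\<in>carrier L. p \<sqsubseteq> w \<longrightarrow> z \<sqsubseteq> w \<longrightarrow> q \<sqsubseteq> w)"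
  shows "coatom (interval L u v) m" "left_modular (interval L u v) m"
proof -
  interpret I: lattice "interval L u v"
    using uv by (intro lattice_interval)
  show "left_modular (interval L u v) m"
  proof (rule I.left_modularI)
    fix p q
    assume "p \<in> carrier (interval L u v)" "q \<in> carrier (interval L u v)"
      "p \<sqsubseteq>\<^bsub>interval L u v\<^esub> q" "\<not> p \<sqsubseteq>\<^bsub>interval L u v\<^esub> m"
    then have *: "p \<in> carrier L" "q \<in> carrier L" "u \<sqsubseteq> p" "p \<sqsubseteq> q" "q \<sqsubseteq> v" "\<not> p \<sqsubseteq> m"
      by auto
    show "\<exists>z\<in>carrier (interval L u v). z \<sqsubseteq>\<^bsub>interval L u v\<^esub> m \<and> z \<sqsubseteq>\<^bsub>interval L u v\<^esub> q \<and>
       (\<forall>w\<in>carrier (interval L u v). p \<sqsubseteq>\<^bsub>interval L u v\<^esub> w \<longrightarrow>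
          z \<sqsubseteq>\<^bsub>interval L u v\<^esub> w \<longrightarrow> q \<sqsubseteq>\<^bsub>interval L u v\<^esub> w)"
      using ex[OF *] * uv by (auto intro: le_trans)
  qed (use m in auto)
  \<comment> \<open>The top of the interval is defined by choice among greatest elements; uniqueness
    identifies it with \<open>v\<close>.\<close>
  have g: "greatest (interval L u v) v (carrier (interval L u v))"
    using uv by (auto simp: greatest_def)
  then have top: "\<top>\<^bsub>interval L u v\<^esub> = v"
    unfolding top_def by (rule some_equality) (rule I.greatest_unique[OF _ g])
  show "coatom (interval L u v) m"
    unfolding coatom_def top
  proof (intro conjI notI)
    show "m \<in> carrier (interval L u v)" "m \<sqsubset>\<^bsub>interval L u v\<^esub> v"
      using m by (auto simp: lless_def eq_is_equal)
    assume "\<exists>z\<in>carrier (interval L u v). m \<sqsubset>\<^bsub>interval L u v\<^esub> z \<and> z \<sqsubset>\<^bsub>interval L u v\<^esub> v"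
    then obtain p where p: "p \<in> carrier L" "u \<sqsubseteq> p" "p \<sqsubseteq> v" "m \<sqsubseteq> p" "m \<noteq> p" "p \<noteq> v"
      by (auto simp: lless_def eq_is_equal)
    then have "\<not> p \<sqsubseteq> m"
      using m by blast
    with p uv obtain z where z: "z \<in> carrier L" "z \<sqsubseteq> m"
      and w: "\<And>w. w \<in> carrier L \<Longrightarrow> p \<sqsubseteq> w \<Longrightarrow> z \<sqsubseteq> w \<Longrightarrow> v \<sqsubseteq> w"
      using ex[of p v] by auto
    \<comment> \<open>Here \<open>z \<sqsubseteq> m \<sqsubseteq> p\<close>, so \<open>p\<close>
      itself can serve as the upper bound \<open>w\<close>.\<close>
    have "v \<sqsubseteq> p"
      using p z m by (intro w) (auto intro: le_trans)
    with p uv show False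
      by (meson le_antisym)
  qed
qed

end

subsection \<open>Partitions with admissible blocks\<close>

text \<open>The ground set is arbitrary so that the notion also applies inside a single block, and
  such pieces can be glued.\<close>

definition k_equal :: "nat \<Rightarrow> 'a set \<Rightarrow> 'a set set \<Rightarrow> bool" where
  "k_equal k A P \<longleftrightarrow> partition_on A P \<and> (\<forall>B\<in>P. card B \<noteq> 1 \<longrightarrow> k \<le> card B)"

text \<open>For finite nonempty \<open>S\<close> this is the greatest k-equal partition of
  \<open>S\<close>.\<close>

definition coarsest :: "nat \<Rightarrow> 'a set \<Rightarrow> 'a set set" where
  "coarsest k S = (if card S = 1 \<or> k \<le> card S then {S} else (\<lambda>x. {x}) ` S)"

lemma k_equal_coarsest: "S \<noteq> {} \<Longrightarrow> k_equal k S (coarsest k S)"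
  by (auto simp: k_equal_def coarsest_def partition_on_space partition_on_singletons)

text \<open>A singleton fits into either form of \<open>coarsest k S\<close>. Any other admissible
  \<open>X\<close> forces \<open>k \<le> card S\<close>, so \<open>S\<close> has not been
  shattered.\<close>

lemma coarsest_covers:
  assumes "finite S" "X \<subseteq> S" "card X \<noteq> 1 \<longrightarrow> k \<le> card X"
  shows "\<exists>Y\<in>coarsest k S. X \<subseteq> Y"
proof (cases "card X = 1")
  case True
  then obtain x where "X = {x}"
    by (auto simp: card_1_singleton_iff)
  with assms show ?thesis
    by (auto simp: coarsest_def)
next
  case False
  then have "k \<le> card S"
    using assms card_mono[of S X] by auto
  with assms show ?thesis
    by (auto simp: coarsest_def)
qed

lemma k_equal_UN:
  assumes "partition_on A P" "\<And>B. B \<in> P \<Longrightarrow> k_equal k B (f B)"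
  shows "k_equal k A (\<Union>B\<in>P. f B)"
  using assms partition_on_UN[of A P f] by (auto simp: k_equal_def)

lemma refines_UN:
  assumes "partition_on A P" "\<And>B. B \<in> P \<Longrightarrow> partition_on B (f B)"
  shows "refines A (\<Union>B\<in>P. f B) P"
  unfolding refines_def
proof (intro conjI ballI assms(1) partition_on_UN assms(2))
  fix X assume "X \<in> (\<Union>B\<in>P. f B)"
  then obtain B where B: "B \<in> P" "X \<in> f B"
    by blast
  then have "X \<subseteq> B"
    using partition_onD1[OF assms(2)] by blast
  with B show "\<exists>Y\<in>P. X \<subseteq> Y"
    by blast
qed

text \<open>The common refinement may have blocks of forbidden size, so each block is replaced by
  its coarsest k-equal partition. A k-equal lower bound \<open>R\<close> refines the common
  refinement, and its blocks survive the replacement by \<open>coarsest_covers\<close>.\<close>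

lemma k_equal_inf_exists:
  assumes A: "finite A" and P: "k_equal k A P" and Q: "k_equal k A Q"
  obtains M where "k_equal k A M" "refines A M P" "refines A M Q"
    "\<And>R. \<lbrakk>k_equal k A R; refines A R P; refines A R Q\<rbrakk> \<Longrightarrow> refines A R M"
proof
  define C where "C = common_refinement {P, Q}"
  have PQ: "partition_on A T" if "T \<in> {P, Q}" for T
    using that P Q by (auto simp: k_equal_def)
  have C: "partition_on A C"
    unfolding C_def using PQ by (intro partition_on_common_refinement) auto
  have "refines A C P" "refines A C Q"
    unfolding C_def using PQ by (auto intro!: refines_common_refinement)
  moreover have ce: "k_equal k B (coarsest k B)" if "B \<in> C" for B
    using that partition_onD3[OF C] by (intro k_equal_coarsest) auto
  moreover have "refines A (\<Union>B\<in>C. coarsest k B) C"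
    using C ce by (intro refines_UN) (auto simp: k_equal_def)
  ultimately show "refines A (\<Union>B\<in>C. coarsest k B) P" "refines A (\<Union>B\<in>C. coarsest k B) Q"
    by (auto intro: refines_trans)
  show M: "k_equal k A (\<Union>B\<in>C. coarsest k B)"
    using C ce by (intro k_equal_UN)
  fix R assume R: "k_equal k A R" "refines A R P" "refines A R Q"
  have RC: "refines A R C"
    unfolding C_def using PQ R by (intro common_refinement_coarsest) (auto simp: k_equal_def)
  have "\<exists>Y\<in>(\<Union>B\<in>C. coarsest k B). X \<subseteq> Y" if X: "X \<in> R" for X
  proof -
    obtain B where B: "B \<in> C" "X \<subseteq> B"
      using RC X by (auto simp: refines_def)
    then have "finite B"
      using A partition_onD1[OF C] by (auto intro: finite_subset)
    then show ?thesis
      using coarsest_covers[of B X k] B X R by (auto simp: k_equal_def)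
  qed
  then show "refines A R (\<Union>B\<in>C. coarsest k B)"
    using M R by (auto simp: refines_def k_equal_def)
qed

text \<open>For nonempty \<open>D\<close> at most one block of a partition \<open>Q\<close> is
  changed. If \<open>D\<close> is a block of a k-equal \<open>u\<close> refining \<open>Q\<close>,
  the result is the greatest k-equal partition below \<open>Q\<close> that has \<open>D\<close> as a
  block. The union over blocks gives access to the gluing lemmas.\<close>

definition split_off :: "nat \<Rightarrow> 'a set \<Rightarrow> 'a set set \<Rightarrow> 'a set set" where
  "split_off k D Q = (\<Union>B\<in>Q. if D \<subset> B then insert D (coarsest k (B - D)) else {B})"

context
  fixes k :: nat and A D :: "'a set" and u :: "'a set set"
  assumes A: "finite A" and u: "k_equal k A u" and D: "D \<in> u"
begin

text \<open>As a block of \<open>u\<close>, \<open>D\<close> has admissible size, and strict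
  inclusion keeps \<open>B - D\<close> nonempty, so the pieces of \<open>B\<close> form a k-equal
  partition of it.\<close>

lemma split_off:
  assumes Q: "k_equal k A Q"
  shows "k_equal k A (split_off k D Q)" "refines A (split_off k D Q) Q"
proof -
  have D': "D \<noteq> {}" "card D \<noteq> 1 \<longrightarrow> k \<le> card D"
    using u D by (auto simp: k_equal_def dest: partition_onD3)
  have *: "k_equal k B (if D \<subset> B then insert D (coarsest k (B - D)) else {B})" if "B \<in> Q" for B
  proof (cases "D \<subset> B")
    case True
    then have c: "k_equal k (B - D) (coarsest k (B - D))"
      by (intro k_equal_coarsest) auto
    moreover have "\<Union>(coarsest k (B - D)) = B - D"
      using c by (auto simp: k_equal_def dest: partition_onD1)
    ultimately show ?thesis
      using True D' partition_on_insert[of D "coarsest k (B - D)" B]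
      by (auto simp: k_equal_def disjnt_iff)
  next
    case False
    moreover have "partition_on B {B}"
      using Q that by (intro partition_on_space) (auto simp: k_equal_def dest: partition_onD3)
    ultimately show ?thesis
      using Q that by (auto simp: k_equal_def)
  qed
  show "k_equal k A (split_off k D Q)"
    unfolding split_off_def using Q * by (intro k_equal_UN) (auto simp: k_equal_def)
  show "refines A (split_off k D Q) Q"
    unfolding split_off_def using Q * by (intro refines_UN) (auto simp: k_equal_def)
qed

lemma in_split_off:
  assumes "refines A u Q"
  shows "D \<in> split_off k D Q"
proof -
  obtain B where "B \<in> Q" "D \<subseteq> B"
    using assms D by (auto simp: refines_def)
  then show ?thesis
    by (cases "D = B") (auto simp: split_off_def)
qed

text \<open>A block of \<open>R\<close> other than \<open>D\<close> is disjoint from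
  \<open>D\<close>. If it lies in the block \<open>B\<close> that is split, it lies in
  \<open>B - D\<close> and is covered by \<open>coarsest k (B - D)\<close>.\<close>

lemma refines_split_off:
  assumes Q: "k_equal k A Q" and R: "k_equal k A R" "refines A R Q" "D \<in> R"
  shows "refines A R (split_off k D Q)"
proof -
  have "\<exists>Y\<in>split_off k D Q. X \<subseteq> Y" if X: "X \<in> R" for X
  proof -
    obtain B where B: "B \<in> Q" "X \<subseteq> B"
      using R X by (auto simp: refines_def)
    show ?thesis
    proof (cases "D \<subset> B \<and> X \<noteq> D")
      case True
      then have "X \<inter> D = {}"
        using R X partition_on_same_block[of A R X D] by (auto simp: k_equal_def)
      moreover have "finite (B - D)"
        using A B Q partition_onD1[of A Q] by (auto simp: k_equal_def intro: finite_subset)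
      ultimately obtain Y where "Y \<in> coarsest k (B - D)" "X \<subseteq> Y"
        using coarsest_covers[of "B - D" X k] B X R by (auto simp: k_equal_def)
      then show ?thesis
        using B True by (auto simp: split_off_def)
    next
      case False
      then show ?thesis
        using B by (auto simp: split_off_def)
    qed
  qed
  then show ?thesis
    using R split_off[OF Q] by (auto simp: refines_def k_equal_def)
qed

text \<open>If \<open>E\<close> is the block of \<open>q\<close> containing \<open>D\<close> and \<open>E - D\<close> is too small to be a block, then \<open>u\<close> has
  singletons in \<open>E\<close>. By the choice of \<open>D\<close>, it is itself a singleton and \<open>card E \<le> k\<close>,
  so the block of \<open>p\<close> that properly contains \<open>D\<close> must be all of \<open>E\<close>.\<close>

lemma refines_of_split_off:
  assumes p: "k_equal k A p" "refines A u p" "D \<notin> p"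
    and q: "k_equal k A q" "refines A p q"
    and small: "\<And>E X. \<lbrakk>E \<in> q; D \<subseteq> E; X \<in> u; X \<subseteq> E; card X = 1\<rbrakk> \<Longrightarrow> card D = 1"
    and w: "refines A p w" "refines A (split_off k D q) w"
  shows "refines A q w"
proof -
  obtain F where F: "F \<in> p" "D \<subset> F"
    using p D unfolding refines_def by (metis psubsetI)
  obtain E where E: "E \<in> q" "F \<subseteq> E"
    using F q unfolding refines_def by metis
  obtain W where W: "W \<in> w" "F \<subseteq> W"
    using F w unfolding refines_def by metis
  have parts: "partition_on A q" "partition_on A w" "partition_on A u"
    using q w u by (auto simp: k_equal_def refines_def)
  have finE: "finite E"
    using A E partition_onD1[OF parts(1)] by (auto intro: finite_subset)
  have D_ne: "D \<noteq> {}"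
    using D parts partition_onD3 by blast
  \<comment> \<open>Only \<open>E\<close> is broken up by the splitting; every other block of
    \<open>q\<close> is still a block of \<open>split_off k D q\<close> and so lies in a block of
    \<open>w\<close>.\<close>
  have EW: "E \<subseteq> W"
  proof (cases "card (E - D) = 1 \<or> k \<le> card (E - D)")
    case True
    \<comment> \<open>Now \<open>E - D\<close> stays whole. It meets \<open>F\<close> because
      \<open>D \<subset> F\<close>, so the blocks of \<open>w\<close> containing \<open>F\<close>
      and \<open>E - D\<close> coincide.\<close>
    then have "E - D \<in> coarsest k (E - D)"
      by (simp add: coarsest_def)
    moreover have "D \<subset> E"
      using E F by blast
    ultimately have "E - D \<in> split_off k D q"
      using E unfolding split_off_def by (intro UN_I[of E]) auto
    then obtain W' where W': "W' \<in> w" "E - D \<subseteq> W'"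
      using w by (auto simp: refines_def)
    obtain x where "x \<in> F - D"
      using F by auto
    then have "W = W'"
      using W W' E partition_on_same_block[OF parts(2), of W W' x] by auto
    then show ?thesis
      using W W' F by auto
  next
    case False
    obtain x where x: "x \<in> E - D"
      using E F by auto
    then have "x \<in> A"
      using E partition_onD1[OF parts(1)] by auto
    then obtain X where X: "X \<in> u" "x \<in> X"
      using partition_onD1[OF parts(3)] by auto
    obtain E' where "E' \<in> q" "X \<subseteq> E'"
      using X p q refines_trans[of A u p q] by (auto simp: refines_def)
    then have XE: "X \<subseteq> E"
      using X x E partition_on_same_block[OF parts(1), of E E' x] by auto
    have "X \<inter> D = {}"
      using X x D partition_on_same_block[OF parts(3), of X D] by auto
    then have "card X \<le> card (E - D)"
      using XE finE by (intro card_mono) auto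
    then have "card X = 1"
      using False u X by (auto simp: k_equal_def)
    then have D1: "card D = 1"
      using small[of E X] E F X XE by auto
    \<comment> \<open>From \<open>card (E - D) < k\<close> and \<open>card D = 1\<close>; the bound
      is exactly what is needed against \<open>k \<le> card F\<close>.\<close>
    then have "card E \<le> k"
      using False card_Diff_subset[of D E] finE E F
      by (auto simp: card_ge_0_finite)
    moreover have "card F \<noteq> 1"
      using F D1 finE E psubset_card_mono[of F D] by (auto dest: finite_subset)
    then have "k \<le> card F"
      using p F by (auto simp: k_equal_def)
    ultimately have "F = E"
      using finE E by (intro card_seteq) auto
    then show ?thesis
      using W by simp
  qed
  have "\<exists>Y\<in>w. X \<subseteq> Y" if X: "X \<in> q" for X
  proof (cases "X = E")
    case True
    then show ?thesis
      using EW W by blast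
  next
    case False
    then have "\<not> D \<subset> X"
      using X E F D_ne partition_on_same_block[OF parts(1), of X E] by blast
    then have "X \<in> split_off k D q"
      using X by (auto simp: split_off_def)
    then show ?thesis
      using w by (auto simp: refines_def)
  qed
  then show ?thesis
    using parts by (auto simp: refines_def)
qed

end

subsection \<open>The \<open>k\<close>-equal partition lattice\<close>

lemma k_equal_partition_lattice_simps [simp]:
  "carrier (k_equal_partition_lattice n k) = {P. k_equal k {1..n} P}"
  "le (k_equal_partition_lattice n k) = refines {1..n}"
  "eq (k_equal_partition_lattice n k) = (=)"
  by (auto simp: k_equal_partition_lattice_def partition_lattice_def k_equal_def)

lemma lattice_k_equal_partition_lattice:
  assumes "1 \<le> k" "k \<le> n"
  shows "lattice (k_equal_partition_lattice n k)" (is "lattice ?L")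
proof -
  interpret partial_order ?L
    by unfold_locales
      (auto simp: k_equal_def intro: refines_refl refines_trans dest: refines_asym)
  interpret lower_semilattice ?L
  proof
    fix P Q assume PQ: "P \<in> carrier ?L" "Q \<in> carrier ?L"
    then obtain M where M: "k_equal k {1..n} M" "refines {1..n} M P" "refines {1..n} M Q"
      "\<And>R. \<lbrakk>k_equal k {1..n} R; refines {1..n} R P; refines {1..n} R Q\<rbrakk> \<Longrightarrow> refines {1..n} R M"
      using k_equal_inf_exists[of "{1..n}" k P Q] by auto
    then have "greatest ?L M (Lower ?L {P, Q})"
      using PQ by (intro greatest_LowerI) (auto simp: Lower_def)
    then show "\<exists>s. greatest ?L s (Lower ?L {P, Q})" ..
  qed
  show ?thesis
  proof
    fix P Q assume PQ: "P \<in> carrier ?L" "Q \<in> carrier ?L"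
    show "\<exists>s. least ?L s (Upper ?L {P, Q})"
    proof (rule finite_top_imp_sup_of_two[OF _ _ _ PQ])
      show "finite (carrier ?L)"
        by (rule finite_subset[OF _ finitely_many_partition_on[of "{1..n}"]])
          (auto simp: k_equal_def)
      \<comment> \<open>\<open>k \<le> n\<close> makes the one-block partition admissible, and with
        \<open>1 \<le> k\<close> the block is nonempty.\<close>
      have t: "k_equal k {1..n} {{1..n}}"
        using assms by (auto simp: k_equal_def partition_on_space)
      then show "{{1..n}} \<in> carrier ?L"
        by simp
      show "R \<sqsubseteq>\<^bsub>?L\<^esub> {{1..n}}" if "R \<in> carrier ?L" for R
        using that t by (auto simp: refines_def k_equal_def dest: partition_onD1)
    qed
  qed
qed

text \<open>By antisymmetry \<open>v\<close> does not refine \<open>u\<close>, so some block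
  \<open>C\<close> of \<open>v\<close> is missing from \<open>u\<close> and contains a block of
  \<open>u\<close> properly. A singleton of \<open>u\<close> inside \<open>C\<close> is preferred to
  it, as \<open>refines_of_split_off\<close> requires.\<close>

lemma obtain_splitting_block:
  assumes "refines A u v" "u \<noteq> v"
  obtains C D where "C \<in> v" "D \<in> u" "D \<subset> C"
    "\<And>X. \<lbrakk>X \<in> u; X \<subseteq> C; card X = 1\<rbrakk> \<Longrightarrow> card D = 1"
proof -
  obtain D0 C where C: "D0 \<in> u" "C \<in> v" "D0 \<subset> C"
  proof -
    have parts: "partition_on A u" "partition_on A v"
      using assms by (auto simp: refines_def)
    have "\<not> refines A v u"
      using assms refines_asym by blast
    then obtain C where C: "C \<in> v" "C \<notin> u"
      using parts by (auto simp: refines_def)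
    then obtain x where x: "x \<in> C" "x \<in> A"
      using partition_onD3[OF parts(2)] partition_onD1[OF parts(2)] by (metis Union_iff ex_in_conv)
    then obtain D where D: "D \<in> u" "x \<in> D"
      using parts partition_onD1[of A u] by blast
    obtain C' where C': "C' \<in> v" "D \<subseteq> C'"
      using assms D by (auto simp: refines_def)
    have "C' = C"
      using partition_on_same_block[OF parts(2) C'(1) C(1), of x] x D C' by blast
    then show ?thesis
      using that[of D C] C C' D by blast
  qed
  show ?thesis
  proof (cases "\<exists>X\<in>u. X \<subseteq> C \<and> card X = 1")
    case True
    then obtain X where X: "X \<in> u" "X \<subseteq> C" "card X = 1"
      by auto
    \<comment> \<open>\<open>C\<close> properly contains the nonempty set \<open>D0\<close>, so it
      is no singleton.\<close>
    have "X \<noteq> C"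
    proof
      assume "X = C"
      then obtain y where "C = {y}"
        using X by (auto simp: card_1_singleton_iff)
      then have "D0 = {}"
        using C by auto
      then show False
        using C assms by (auto simp: refines_def dest: partition_onD3)
    qed
    then show ?thesis
      using that[of C X] C X by auto
  next
    case False
    then show ?thesis
      using that[of C D0] C by blast
  qed
qed

theorem theorem6p1:
  fixes n k :: nat
  assumes "1 \<le> k" and "k \<le> n"
  shows "comodernistic (k_equal_partition_lattice n k)"
proof -
  let ?L = "k_equal_partition_lattice n k" and ?A = "{1..n}"
  interpret lattice ?L
    using assms by (rule lattice_k_equal_partition_lattice)
  have "\<exists>m. coatom (interval ?L u v) m \<and> left_modular (interval ?L u v) m"
    if u: "k_equal k ?A u" and v: "k_equal k ?A v" and uv: "refines ?A u v" "u \<noteq> v" for u v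
  proof -
    obtain C D where C: "C \<in> v" and D: "D \<in> u" and DC: "D \<subset> C"
      and small: "\<And>X. \<lbrakk>X \<in> u; X \<subseteq> C; card X = 1\<rbrakk> \<Longrightarrow> card D = 1"
      using obtain_splitting_block[OF uv] by metis
    have A: "finite ?A"
      by simp
    have D0: "D \<noteq> {}"
      using D u by (auto simp: k_equal_def dest: partition_onD3)
    have parts: "partition_on ?A v"
      using v by (simp add: k_equal_def)
    have Dv: "D \<notin> v"
      using partition_on_same_block[OF parts, of C D] C DC D0 by blast
    note S = split_off[OF A u D] and S_ge = refines_split_off[OF A u D]
      and S_in = in_split_off[OF A u D]
    let ?m = "split_off k D v"
    have ex: "\<exists>z\<in>carrier ?L. u \<sqsubseteq>\<^bsub>?L\<^esub> z \<and> z \<sqsubseteq>\<^bsub>?L\<^esub> ?m \<and> z \<sqsubseteq>\<^bsub>?L\<^esub> q \<and>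
        (\<forall>w\<in>carrier ?L. p \<sqsubseteq>\<^bsub>?L\<^esub> w \<longrightarrow> z \<sqsubseteq>\<^bsub>?L\<^esub> w \<longrightarrow> q \<sqsubseteq>\<^bsub>?L\<^esub> w)"
      if "p \<in> carrier ?L" "q \<in> carrier ?L" "u \<sqsubseteq>\<^bsub>?L\<^esub> p" "p \<sqsubseteq>\<^bsub>?L\<^esub> q" "q \<sqsubseteq>\<^bsub>?L\<^esub> v" "\<not> p \<sqsubseteq>\<^bsub>?L\<^esub> ?m"
      for p q
    proof -
      have p: "k_equal k ?A p" "refines ?A u p" and q: "k_equal k ?A q" "refines ?A p q"
        and qv: "refines ?A q v" and pm: "\<not> refines ?A p ?m"
        using that by auto
      have uq: "refines ?A u q" and pv: "refines ?A p v"
        using p q qv by (auto intro: refines_trans)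
      have Dp: "D \<notin> p"
        using S_ge[OF v p(1) pv] pm by blast
      \<comment> \<open>\<open>C\<close> is the only block of \<open>v\<close> meeting
        \<open>D\<close>, so \<open>E\<close> lies inside \<open>C\<close> and the choice of
        \<open>D\<close> applies.\<close>
      have small': "card D = 1"
        if X: "E \<in> q" "D \<subseteq> E" "X \<in> u" "X \<subseteq> E" "card X = 1" for E X
      proof -
        obtain C' where "C' \<in> v" "E \<subseteq> C'"
          using qv X by (auto simp: refines_def)
        moreover then have "C' = C"
          using X D0 C DC partition_on_same_block[OF parts, of C' C] by blast
        ultimately show ?thesis
          using small[of X] X by auto
      qed
      have "refines ?A (split_off k D q) v"
        using S[OF q(1)] qv by (auto intro: refines_trans)
      \<comment> \<open>The exchange witness \<open>split_off k D q\<close> lies below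
        \<open>v\<close> and has \<open>D\<close> as a block, so it lies below \<open>?m\<close> by
        maximality of the splitting.\<close>
      then have "refines ?A (split_off k D q) ?m"
        using S[OF q(1)] S_in[OF uq] by (intro S_ge[OF v])
      then show ?thesis
        using S[OF q(1)] S_ge[OF q(1) u uq D] refines_of_split_off[OF A u D p Dp q small']
        by (intro bexI[of _ "split_off k D q"]) auto
    qed
    have "?m \<noteq> v"
      using S_in[OF uv(1)] Dv by auto
    then have "coatom (interval ?L u v) ?m" "left_modular (interval ?L u v) ?m"
      using u v uv S[OF v] S_ge[OF v u uv(1) D]
      by (intro interval_left_modular_coatomI ex; simp)+
    then show ?thesis
      by blast
  qed
  then show ?thesis
    unfolding comodernistic_def using lattice_axioms
    by (auto simp: lless_def)
qed

end
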